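(* Let $G=(V,E)$ be a finite graph, $\ell\colon E\to(0,+\infty)$ an edge length function, $\Gamma$ the corresponding metric graph, and $D$ a $G$-admissible divisor of degree $d$ on $\Gamma$. (1) The semistability polytope $\mathbf{P}_D\subset H_d$ is the set of points $q\in H_d$ that verify the inequalities $$|q(I)-q_D(I)|\le\frac{e_D(I,I^c)}{2}\quad\text{for each subset } I\subseteq V.$$ (2) The semistability polytope $\mathbf{P}_D$ coincides with the base polytope $\mathbf{P}_{\mu_D}$ associated to the adjoint modular pair $(\mu_D,\mu_D^* )$ of $D$.
   Context: $H_d=\{q\in\mathbb{R}^V:\sum_{v}q(v)=d\}$; for $q\in\mathbb{R}^V$ and $I\subseteq V$, $q(I)=\sum_{v\in I}q(v)$ and $I^c=V\setminus I$. The metric graph $\Gamma$ is obtained from $G$ by replacing each edge $e$ by an interval of length $\ell_e=\ell(e)$. A divisor is a finite formal sum $D=\sum_{x\in\Gamma}D(x)(x)$ with $D(x)\in\mathbb{Z}$; its degree is $\sum_xD(x)$. It is $G$-admissible if for each edge $e$ of $G$, $D$ vanishes at every point of the interior of $e$ with at most one exception $x$, for which $D(x)=1$. For $I\subseteq V$, $\Gamma_I\subseteq\Gamma$ is the union of $I$ and of all edges with both extremities in $I$, and $\deg(D_I):=\sum_{x\in\Gamma_I}D(x)$. Let $e(I,I^c)$ be the number of edges of $G$ joining a vertex of $I$ to one of $I^c$. Let $e_D(I,I^c)$ be the number of those containing no point of the support of $D$ in their interior, and $\delta_D(I,I^c):=e(I,I^c)-e_D(I,I^c)$. Semistability polytope: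 $\mathbf{P}_D:=\{q\in H_d:|\deg(D_I)-q(I)|\le\tfrac12e(I,I^c)\text{ for each }\emptyset\subsetneq I\subsetneq V\}$. $q_D(I):=\deg(D_I)+\tfrac12\delta_D(I,I^c)$ for $I\subseteq V$; this is a modular function, i.e. given by an element $q_D\in H_d$. $\mu_D(I):=\deg(D_I)-e_D(I,I^c)+\tfrac12e(I,I^c)$ and $\mu_D^*(I):=\deg(D_I)+\tfrac12e(I,I^c)$. The base polytope is $\mathbf{P}_{\mu_D}:=\{q\in\mathbb{R}^V:\mu_D(I)\le q(I)\le\mu_D^*(I)\ \forall I\subseteq V\}$. *)

theory Defs
  imports
    Complex_Main
    "HOL-Library.FuncSet"
    "HOL-Library.Poly_Mapping"
    "Graph_Theory.Digraph"
begin

text \<open>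
  A finite graph, possibly with loops and multiple edges and possibly disconnected, is given by
  \<open>G\<close> with \<open>fin_digraph G\<close>: each element of \<open>arcs G\<close> is one \<^emph>\<open>undirected\<close> edge with extremities
  \<open>tail G e\<close> and \<open>head G e\<close>. The orientation is an arbitrary reference orientation; it only fixes
  the direction in which the interval replacing \<open>e\<close> is parametrized.
\<close>

definition RV :: "('v, 'e) pre_digraph \<Rightarrow> ('v \<Rightarrow> real) set" where
  "RV G = extensional (verts G)"

definition hyperplane :: "('v, 'e) pre_digraph \<Rightarrow> real \<Rightarrow> ('v \<Rightarrow> real) set" where
  "hyperplane G d = {q \<in> RV G. sum q (verts G) = d}"

text \<open>
  Points of the metric graph \<open>\<Gamma>\<close>: gluing the intervals \<open>[0, len e]\<close> to the vertices along their
  end points leaves the vertices and, for each edge, the points with parameter \<open>0 < t < len e\<close>;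
  \<open>edge_point\<close> is the resulting map from \<open>[0, len e]\<close> to \<open>\<Gamma>\<close>. Only the set of points of \<open>\<Gamma>\<close>,
  with its decomposition into vertices and edges, matters for divisors.
\<close>

datatype ('v, 'e) mpoint = Vertex 'v | Inner 'e real

definition edge_point :: "('v, 'e) pre_digraph \<Rightarrow> ('e \<Rightarrow> real) \<Rightarrow> 'e \<Rightarrow> real \<Rightarrow> ('v, 'e) mpoint" where
  "edge_point G len e t =
     (if t = 0 then Vertex (tail G e) else if t = len e then Vertex (head G e) else Inner e t)"

definition closed_edge :: "('v, 'e) pre_digraph \<Rightarrow> ('e \<Rightarrow> real) \<Rightarrow> 'e \<Rightarrow> ('v, 'e) mpoint set" where
  "closed_edge G len e = edge_point G len e ` {0..len e}"

definition open_edge :: "('v, 'e) pre_digraph \<Rightarrow> ('e \<Rightarrow> real) \<Rightarrow> 'e \<Rightarrow> ('v, 'e) mpoint set" where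
  "open_edge G len e = edge_point G len e ` {0<..<len e}"

definition subgraph_points ::
    "('v, 'e) pre_digraph \<Rightarrow> ('e \<Rightarrow> real) \<Rightarrow> 'v set \<Rightarrow> ('v, 'e) mpoint set" where
  "subgraph_points G len I =
     Vertex ` I \<union> (\<Union>e \<in> {e \<in> arcs G. tail G e \<in> I \<and> head G e \<in> I}. closed_edge G len e)"

definition metric_graph :: "('v, 'e) pre_digraph \<Rightarrow> ('e \<Rightarrow> real) \<Rightarrow> ('v, 'e) mpoint set" where
  "metric_graph G len = Vertex ` verts G \<union> (\<Union>e \<in> arcs G. closed_edge G len e)"

text \<open>
  Finite formal integer sums are finitely supported functions; the support has to lie in \<open>\<Gamma>\<close>.
\<close>

definition divisor_on ::
    "('v, 'e) pre_digraph \<Rightarrow> ('e \<Rightarrow> real) \<Rightarrow> (('v, 'e) mpoint \<Rightarrow>\<^sub>0 int) \<Rightarrow> bool" where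
  "divisor_on G len D \<longleftrightarrow> Poly_Mapping.keys D \<subseteq> metric_graph G len"

definition div_degree :: "('a \<Rightarrow>\<^sub>0 int) \<Rightarrow> int" where
  "div_degree D = (\<Sum>x \<in> Poly_Mapping.keys D. Poly_Mapping.lookup D x)"

definition admissible ::
    "('v, 'e) pre_digraph \<Rightarrow> ('e \<Rightarrow> real) \<Rightarrow> (('v, 'e) mpoint \<Rightarrow>\<^sub>0 int) \<Rightarrow> bool" where
  "admissible G len D \<longleftrightarrow>
     (\<forall>e \<in> arcs G.
        (\<forall>x \<in> open_edge G len e. Poly_Mapping.lookup D x = 0) \<or>
        (\<exists>x \<in> open_edge G len e. Poly_Mapping.lookup D x = 1 \<and>
           (\<forall>y \<in> open_edge G len e. y \<noteq> x \<longrightarrow> Poly_Mapping.lookup D y = 0)))"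

text \<open>
  \<open>deg_on\<close> is \<open>deg(D\<^sub>I)\<close>: the sum over \<open>\<Gamma>\<^sub>I\<close>, in general infinite, is taken over the support of \<open>D\<close>
  in it.
\<close>

definition deg_on ::
    "('v, 'e) pre_digraph \<Rightarrow> ('e \<Rightarrow> real) \<Rightarrow> (('v, 'e) mpoint \<Rightarrow>\<^sub>0 int) \<Rightarrow> 'v set \<Rightarrow> int" where
  "deg_on G len D I = (\<Sum>x \<in> Poly_Mapping.keys D \<inter> subgraph_points G len I. Poly_Mapping.lookup D x)"

definition edges_between :: "('v, 'e) pre_digraph \<Rightarrow> 'v set \<Rightarrow> 'v set \<Rightarrow> 'e set" where
  "edges_between G I J =
     {e \<in> arcs G. tail G e \<in> I \<and> head G e \<in> J \<or> tail G e \<in> J \<and> head G e \<in> I}"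

definition e_num :: "('v, 'e) pre_digraph \<Rightarrow> 'v set \<Rightarrow> 'v set \<Rightarrow> nat" where
  "e_num G I J = card (edges_between G I J)"

definition eD_num ::
    "('v, 'e) pre_digraph \<Rightarrow> ('e \<Rightarrow> real) \<Rightarrow> (('v, 'e) mpoint \<Rightarrow>\<^sub>0 int) \<Rightarrow> 'v set \<Rightarrow> 'v set \<Rightarrow> nat" where
  "eD_num G len D I J = card {e \<in> edges_between G I J. Poly_Mapping.keys D \<inter> open_edge G len e = {}}"

definition deltaD_num ::
    "('v, 'e) pre_digraph \<Rightarrow> ('e \<Rightarrow> real) \<Rightarrow> (('v, 'e) mpoint \<Rightarrow>\<^sub>0 int) \<Rightarrow> 'v set \<Rightarrow> 'v set \<Rightarrow> int" where
  "deltaD_num G len D I J = int (e_num G I J) - int (eD_num G len D I J)"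

definition semistability_polytope ::
    "('v, 'e) pre_digraph \<Rightarrow> ('e \<Rightarrow> real) \<Rightarrow> (('v, 'e) mpoint \<Rightarrow>\<^sub>0 int) \<Rightarrow> ('v \<Rightarrow> real) set" where
  "semistability_polytope G len D =
     {q \<in> hyperplane G (of_int (div_degree D)).
        \<forall>I. I \<noteq> {} \<and> I \<subset> verts G \<longrightarrow>
          \<bar>of_int (deg_on G len D I) - sum q I\<bar> \<le> 1/2 * real (e_num G I (verts G - I))}"

definition qD ::
    "('v, 'e) pre_digraph \<Rightarrow> ('e \<Rightarrow> real) \<Rightarrow> (('v, 'e) mpoint \<Rightarrow>\<^sub>0 int) \<Rightarrow> 'v set \<Rightarrow> real" where
  "qD G len D I = of_int (deg_on G len D I) + 1/2 * of_int (deltaD_num G len D I (verts G - I))"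

definition muD ::
    "('v, 'e) pre_digraph \<Rightarrow> ('e \<Rightarrow> real) \<Rightarrow> (('v, 'e) mpoint \<Rightarrow>\<^sub>0 int) \<Rightarrow> 'v set \<Rightarrow> real" where
  "muD G len D I =
     of_int (deg_on G len D I) - real (eD_num G len D I (verts G - I))
       + 1/2 * real (e_num G I (verts G - I))"

definition muD_star ::
    "('v, 'e) pre_digraph \<Rightarrow> ('e \<Rightarrow> real) \<Rightarrow> (('v, 'e) mpoint \<Rightarrow>\<^sub>0 int) \<Rightarrow> 'v set \<Rightarrow> real" where
  "muD_star G len D I = of_int (deg_on G len D I) + 1/2 * real (e_num G I (verts G - I))"

definition base_polytope ::
    "('v, 'e) pre_digraph \<Rightarrow> ('v set \<Rightarrow> real) \<Rightarrow> ('v set \<Rightarrow> real) \<Rightarrow> ('v \<Rightarrow> real) set" where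
  "base_polytope G \<mu> \<mu>s = {q \<in> RV G. \<forall>I \<subseteq> verts G. \<mu> I \<le> sum q I \<and> sum q I \<le> \<mu>s I}"

end

theory Submission
  imports Defs
begin

text \<open>
  Everything follows from one counting identity. Write \<open>deg(I)\<close> for the degree of \<open>D\<close> on \<open>\<Gamma>\<^sub>I\<close>, and
  \<open>e\<close>, \<open>e\<^sub>D\<close>, \<open>\<delta>\<^sub>D\<close> for the edge counts across the cut \<open>(I, I\<^sup>c)\<close>. Cutting \<open>\<Gamma>\<close> along \<open>I\<close> leaves \<open>\<Gamma>\<^sub>I\<close>,
  its counterpart for \<open>I\<^sup>c\<close>, and the interiors of the edges that join the two sides. Admissibility
  says that \<open>D\<close> has degree 1 on the interior of such an edge if its support meets it, and degree 0
  otherwise, so that the third piece carries degree \<open>\<delta>\<^sub>D\<close>. Hence \<open>deg(I) + deg(I\<^sup>c) + \<delta>\<^sub>D = d\<close>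
  (lemma \<open>deg_on_complement\<close>).

  On \<open>H\<^sub>d\<close>, where \<open>q(I\<^sup>c) = d - q(I)\<close>, this turns the semistability upper bound
  \<open>q(I\<^sup>c) \<le> deg(I\<^sup>c) + e/2\<close> into the lower bound \<open>q(I) \<ge> deg(I) + \<delta>\<^sub>D - e/2 = \<mu>\<^sub>D(I)\<close>, which implies
  the semistability lower bound at \<open>I\<close> because \<open>e\<^sub>D \<le> e\<close>. The semistability upper bound at \<open>I\<close> is
  \<open>q(I) \<le> \<mu>\<^sub>D\<^sup>*(I)\<close> itself. So semistability amounts to \<open>\<mu>\<^sub>D(I) \<le> q(I) \<le> \<mu>\<^sub>D\<^sup>*(I)\<close> for all \<open>I\<close>
  (lemma \<open>semistability_polytope_eq_between\<close>). Both descriptions in the theorem are readings of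
  this: the interval \<open>[\<mu>\<^sub>D(I), \<mu>\<^sub>D\<^sup>*(I)]\<close> has midpoint \<open>q\<^sub>D(I)\<close> and length \<open>e\<^sub>D\<close>, and at \<open>I = V\<close> it
  shrinks to \<open>{d}\<close>, so that the base polytope lies in \<open>H\<^sub>d\<close>.
\<close>

section \<open>Cutting the metric graph along a vertex set\<close>

lemma open_edge_eq: "open_edge G len e = Inner e ` {0<..<len e}"
  unfolding open_edge_def by (intro image_cong) (auto simp: edge_point_def)

lemma closed_edge_eq:
  assumes "0 < len e"
  shows "closed_edge G len e = {Vertex (tail G e), Vertex (head G e)} \<union> open_edge G len e"
proof -
  have "{0..len e} = {0, len e} \<union> {0<..<len e}"
    using assms by auto
  then have "closed_edge G len e
      = edge_point G len e ` {0, len e} \<union> edge_point G len e ` {0<..<len e}"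
    unfolding closed_edge_def by (simp only: image_Un)
  then show ?thesis
    using assms by (auto simp: open_edge_def edge_point_def)
qed

text \<open>
  Unlike the closed edges of the definition, vertices and open edges are pairwise disjoint; degrees
  are counted along this decomposition.
\<close>

lemma subgraph_points_eq:
  assumes "\<forall>e \<in> arcs G. 0 < len e"
  shows "subgraph_points G len I =
           Vertex ` I \<union> (\<Union>e \<in> {e \<in> arcs G. tail G e \<in> I \<and> head G e \<in> I}. open_edge G len e)"
  using assms by (auto simp: subgraph_points_def closed_edge_eq)

lemma metric_graph_eq_subgraph_points:
  assumes "wf_digraph G"
  shows "metric_graph G len = subgraph_points G len (verts G)"
  using wf_digraph.tail_in_verts[OF assms] wf_digraph.head_in_verts[OF assms]
  by (auto simp: metric_graph_def subgraph_points_def)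

lemma metric_graph_cut:
  assumes "wf_digraph G" and len: "\<forall>e \<in> arcs G. 0 < len e" and "I \<subseteq> verts G"
  shows "metric_graph G len = subgraph_points G len I \<union> subgraph_points G len (verts G - I)
           \<union> (\<Union>e \<in> edges_between G I (verts G - I). open_edge G len e)"
proof -
  let ?inside = "\<lambda>J. {e \<in> arcs G. tail G e \<in> J \<and> head G e \<in> J}"
  have arcs: "?inside (verts G)
      = ?inside I \<union> ?inside (verts G - I) \<union> edges_between G I (verts G - I)"
    using wf_digraph.tail_in_verts[OF assms(1)] wf_digraph.head_in_verts[OF assms(1)] assms(3)
    by (auto simp: edges_between_def)
  have verts: "Vertex ` verts G = Vertex ` I \<union> Vertex ` (verts G - I)"
    using assms(3) by auto
  show ?thesis
    unfolding metric_graph_eq_subgraph_points[OF assms(1)] subgraph_points_eq[OF len] arcs verts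
    by blast
qed

lemma subgraph_points_disjoint:
  assumes "\<forall>e \<in> arcs G. 0 < len e" and "I \<inter> J = {}"
  shows "subgraph_points G len I \<inter> subgraph_points G len J = {}"
  using assms(2) by (auto simp: subgraph_points_eq[OF assms(1)] open_edge_eq)

lemma cut_edges_disjoint_subgraph_points:
  assumes "\<forall>e \<in> arcs G. 0 < len e" and "I \<inter> J = {}"
  shows "(subgraph_points G len I \<union> subgraph_points G len J)
           \<inter> (\<Union>e \<in> edges_between G I J. open_edge G len e) = {}"
  using assms(2) by (auto simp: subgraph_points_eq[OF assms(1)] open_edge_eq edges_between_def)

section \<open>The degree of a divisor across a cut\<close>

lemma admissible_open_edge_degree:
  assumes "admissible G len D" and "e \<in> arcs G"
  shows "(\<Sum>x \<in> Poly_Mapping.keys D \<inter> open_edge G len e. Poly_Mapping.lookup D x)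
           = (if Poly_Mapping.keys D \<inter> open_edge G len e = {} then 0 else 1)"
proof (cases "\<forall>x \<in> open_edge G len e. Poly_Mapping.lookup D x = 0")
  case True
  then have "Poly_Mapping.keys D \<inter> open_edge G len e = {}"
    by (auto simp: in_keys_iff)
  then show ?thesis by simp
next
  case False
  with assms obtain x where x: "x \<in> open_edge G len e" "Poly_Mapping.lookup D x = 1"
    and "\<forall>y \<in> open_edge G len e. y \<noteq> x \<longrightarrow> Poly_Mapping.lookup D y = 0"
    unfolding admissible_def by blast
  then have "Poly_Mapping.keys D \<inter> open_edge G len e = {x}"
    by (auto simp: in_keys_iff)
  with x show ?thesis by simp
qed

lemma finite_edges_between:
  assumes "fin_digraph G"
  shows "finite (edges_between G I J)"
  using fin_digraph.finite_arcs[OF assms] by (simp add: edges_between_def)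

lemma edges_between_commute: "edges_between G I J = edges_between G J I"
  by (auto simp: edges_between_def)

lemma eD_num_le_e_num:
  assumes "fin_digraph G"
  shows "eD_num G len D I J \<le> e_num G I J"
  unfolding eD_num_def e_num_def by (intro card_mono finite_edges_between[OF assms]) auto

text \<open>
  This is why \<open>\<delta>\<^sub>D\<close>, defined as a number of edges, can enter a balance of degrees: the cut edges it
  counts are the ones on whose interior \<open>D\<close> has degree 1 rather than 0.
\<close>

lemma cut_edges_degree:
  assumes "fin_digraph G" and "admissible G len D"
  shows "(\<Sum>x \<in> Poly_Mapping.keys D \<inter> (\<Union>e \<in> edges_between G I J. open_edge G len e).
            Poly_Mapping.lookup D x) = deltaD_num G len D I J"
proof -
  let ?E = "edges_between G I J" and ?K = "\<lambda>e. Poly_Mapping.keys D \<inter> open_edge G len e"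
  have fin: "finite ?E" by (rule finite_edges_between[OF assms(1)])
  have "(\<Sum>x \<in> Poly_Mapping.keys D \<inter> (\<Union>e \<in> ?E. open_edge G len e). Poly_Mapping.lookup D x)
      = (\<Sum>x \<in> (\<Union>e \<in> ?E. ?K e). Poly_Mapping.lookup D x)"
    by (simp only: Int_UN_distrib)
  also have "\<dots> = (\<Sum>e \<in> ?E. \<Sum>x \<in> ?K e. Poly_Mapping.lookup D x)"
    by (rule sum.UNION_disjoint) (use fin in \<open>auto simp: open_edge_eq\<close>)
  \<comment> \<open>written as a difference so that the sum splits into \<open>e\<close> minus \<open>e\<^sub>D\<close>\<close>
  also have "\<dots> = (\<Sum>e \<in> ?E. 1 - (if ?K e = {} then 1 else 0))"
    by (intro sum.cong refl)
      (simp add: admissible_open_edge_degree[OF assms(2)] edges_between_def)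
  also have "\<dots> = deltaD_num G len D I J"
    using fin
    by (simp add: sum_subtractf deltaD_num_def e_num_def eD_num_def sum.If_cases Int_def)
  finally show ?thesis .
qed

text \<open>
  The degree \<open>d\<close> is distributed over the three disjoint pieces into which the cut divides \<open>\<Gamma>\<close>.
\<close>

lemma deg_on_complement:
  assumes "fin_digraph G" and len: "\<forall>e \<in> arcs G. 0 < len e"
    and "divisor_on G len D" and "admissible G len D" and "I \<subseteq> verts G"
  shows "deg_on G len D I + deg_on G len D (verts G - I) + deltaD_num G len D I (verts G - I)
           = div_degree D"
proof -
  let ?J = "verts G - I"
  let ?A = "subgraph_points G len I" and ?B = "subgraph_points G len ?J"
    and ?C = "\<Union>e \<in> edges_between G I ?J. open_edge G len e"
    and ?S = "Poly_Mapping.keys D"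
  have "?S \<subseteq> ?A \<union> ?B \<union> ?C"
    using assms(3) metric_graph_cut[OF fin_digraph.axioms(1)[OF assms(1)] len assms(5)]
    unfolding divisor_on_def by simp
  then have split: "?S = ?S \<inter> ?A \<union> ?S \<inter> ?B \<union> ?S \<inter> ?C"
    by blast
  have "?A \<inter> ?B = {}"
    by (rule subgraph_points_disjoint[OF len]) simp
  then have AB: "(?S \<inter> ?A) \<inter> (?S \<inter> ?B) = {}"
    by blast
  have "(?A \<union> ?B) \<inter> ?C = {}"
    by (rule cut_edges_disjoint_subgraph_points[OF len]) simp
  then have ABC: "(?S \<inter> ?A \<union> ?S \<inter> ?B) \<inter> (?S \<inter> ?C) = {}"
    by blast
  have "sum (Poly_Mapping.lookup D) ?S = sum (Poly_Mapping.lookup D) (?S \<inter> ?A \<union> ?S \<inter> ?B)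
      + sum (Poly_Mapping.lookup D) (?S \<inter> ?C)"
    by (subst split, rule sum.union_disjoint[OF _ _ ABC]) simp_all
  also have "sum (Poly_Mapping.lookup D) (?S \<inter> ?A \<union> ?S \<inter> ?B)
      = sum (Poly_Mapping.lookup D) (?S \<inter> ?A) + sum (Poly_Mapping.lookup D) (?S \<inter> ?B)"
    by (rule sum.union_disjoint[OF _ _ AB]) simp_all
  finally show ?thesis
    unfolding div_degree_def deg_on_def cut_edges_degree[OF assms(1,4)] by simp
qed

section \<open>The semistability polytope between the adjoint pair\<close>

lemma deg_on_empty:
  assumes "\<forall>e \<in> arcs G. 0 < len e"
  shows "deg_on G len D {} = 0"
  by (simp add: deg_on_def subgraph_points_eq[OF assms])

lemma deg_on_verts:
  assumes "wf_digraph G" and "divisor_on G len D"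
  shows "deg_on G len D (verts G) = div_degree D"
  using assms
  by (simp add: deg_on_def div_degree_def divisor_on_def metric_graph_eq_subgraph_points
      Int_absorb2)

lemma e_num_empty [simp]: "e_num G {} J = 0" "e_num G I {} = 0"
  by (simp_all add: e_num_def edges_between_def)

lemma eD_num_empty [simp]: "eD_num G len D {} J = 0" "eD_num G len D I {} = 0"
  by (simp_all add: eD_num_def edges_between_def)

text \<open>
  Semistability constrains only the proper nonempty subsets. The two remaining ones can be added
  because there \<open>\<mu>\<^sub>D\<close> and \<open>\<mu>\<^sub>D\<^sup>*\<close> agree, with common value 0 at the empty set and \<open>d\<close> at \<open>V\<close>, which
  every \<open>q\<close> in \<open>H\<^sub>d\<close> takes too.
\<close>

lemma semistability_polytope_eq_between:
  assumes "fin_digraph G" and len: "\<forall>e \<in> arcs G. 0 < len e"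
    and div: "divisor_on G len D" and "admissible G len D"
  shows "semistability_polytope G len D =
           {q \<in> hyperplane G (of_int (div_degree D)).
              \<forall>I \<subseteq> verts G. muD G len D I \<le> sum q I \<and> sum q I \<le> muD_star G len D I}"
proof (intro set_eqI iffI)
  fix q
  assume "q \<in> semistability_polytope G len D"
  then have q: "q \<in> hyperplane G (of_int (div_degree D))"
    by (simp add: semistability_polytope_def)
  have stable: "\<bar>of_int (deg_on G len D I) - sum q I\<bar> \<le> 1/2 * real (e_num G I (verts G - I))"
    if "I \<noteq> {}" "I \<subset> verts G" for I
    using that \<open>q \<in> semistability_polytope G len D\<close> by (simp add: semistability_polytope_def)
  have "muD G len D I \<le> sum q I \<and> sum q I \<le> muD_star G len D I" if I: "I \<subseteq> verts G" for I
  proof -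
    consider "I = {}" | "I = verts G" | "I \<noteq> {}" "I \<subset> verts G"
      using I by blast
    then show ?thesis
    proof cases
      case 1
      then show ?thesis by (simp add: muD_def muD_star_def deg_on_empty[OF len])
    next
      case 2
      then show ?thesis
        using q deg_on_verts[OF fin_digraph.axioms(1)[OF assms(1)] div]
        by (simp add: muD_def muD_star_def hyperplane_def)
    next
      case 3
      let ?J = "verts G - I"
      have J: "?J \<noteq> {}" "?J \<subset> verts G" "verts G - ?J = I"
        using 3 by auto
      have total: "sum q ?J + sum q I = of_int (div_degree D)"
        using q sum.subset_diff[OF I fin_digraph.finite_verts[OF assms(1)], of q]
        by (simp add: hyperplane_def)
      \<comment> \<open>the lower bound at \<open>I\<close> comes from stability at the complement\<close>
      have "e_num G ?J I = e_num G I ?J"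
        unfolding e_num_def by (simp only: edges_between_commute)
      then have J_stable: "\<bar>of_int (deg_on G len D ?J) - sum q ?J\<bar> \<le> 1/2 * real (e_num G I ?J)"
        using stable[OF J(1,2)] unfolding J(3) by simp
      have deg: "real_of_int (deg_on G len D I) + real_of_int (deg_on G len D ?J)
          + (real (e_num G I ?J) - real (eD_num G len D I ?J)) = real_of_int (div_degree D)"
        using arg_cong[OF deg_on_complement[OF assms I], of real_of_int]
        by (simp add: deltaD_num_def)
      show ?thesis
        using stable[OF 3] J_stable total deg unfolding muD_def muD_star_def abs_le_iff by linarith
    qed
  qed
  with q show "q \<in> {q \<in> hyperplane G (of_int (div_degree D)).
      \<forall>I \<subseteq> verts G. muD G len D I \<le> sum q I \<and> sum q I \<le> muD_star G len D I}"
    by blast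
next
  fix q
  assume asm: "q \<in> {q \<in> hyperplane G (of_int (div_degree D)).
      \<forall>I \<subseteq> verts G. muD G len D I \<le> sum q I \<and> sum q I \<le> muD_star G len D I}"
  then have q: "q \<in> hyperplane G (of_int (div_degree D))"
    by simp
  have between: "muD G len D I \<le> sum q I" "sum q I \<le> muD_star G len D I"
    if "I \<subseteq> verts G" for I
    using that asm by auto
  have "\<bar>of_int (deg_on G len D I) - sum q I\<bar> \<le> 1/2 * real (e_num G I (verts G - I))"
    if "I \<subset> verts G" for I
  proof -
    have "I \<subseteq> verts G" using that by blast
    moreover have "real (eD_num G len D I (verts G - I)) \<le> real (e_num G I (verts G - I))"
      using eD_num_le_e_num[OF assms(1)] by simp
    ultimately show ?thesis
      using between[of I] unfolding muD_def muD_star_def abs_le_iff by linarith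
  qed
  with q show "q \<in> semistability_polytope G len D"
    by (auto simp: semistability_polytope_def)
qed

text \<open>The identity \<open>\<delta>\<^sub>D = e - e\<^sub>D\<close> makes \<open>q\<^sub>D(I)\<close> the midpoint of \<open>\<mu>\<^sub>D(I)\<close> and \<open>\<mu>\<^sub>D\<^sup>*(I)\<close>.\<close>

lemma between_muD_iff_near_qD:
  "muD G len D I \<le> s \<and> s \<le> muD_star G len D I
     \<longleftrightarrow> \<bar>s - qD G len D I\<bar> \<le> real (eD_num G len D I (verts G - I)) / 2"
  unfolding muD_def muD_star_def qD_def deltaD_num_def by (auto simp: abs_le_iff field_simps)

text \<open>
  The base polytope is cut out of all of \<open>\<real>\<^sup>V\<close>; its inequalities at \<open>V\<close> force the total to be \<open>d\<close>,
  since no edge leaves \<open>V\<close>.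
\<close>

lemma base_polytope_subset_hyperplane:
  assumes "wf_digraph G" and "divisor_on G len D"
  shows "base_polytope G (muD G len D) (muD_star G len D)
           \<subseteq> hyperplane G (of_int (div_degree D))"
proof
  fix q
  assume "q \<in> base_polytope G (muD G len D) (muD_star G len D)"
  then have "q \<in> RV G" and "muD G len D (verts G) \<le> sum q (verts G)"
    and "sum q (verts G) \<le> muD_star G len D (verts G)"
    by (auto simp: base_polytope_def)
  then show "q \<in> hyperplane G (of_int (div_degree D))"
    by (simp add: muD_def muD_star_def deg_on_verts[OF assms] hyperplane_def)
qed

theorem theorem4p8:
  fixes G :: "('v, 'e) pre_digraph" and len :: "'e \<Rightarrow> real"
    and D :: "('v, 'e) mpoint \<Rightarrow>\<^sub>0 int" and d :: int
  assumes "fin_digraph G"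
    and "\<And>e. e \<in> arcs G \<Longrightarrow> 0 < len e"
    and "divisor_on G len D"
    and "admissible G len D"
    and "div_degree D = d"
  shows "semistability_polytope G len D =
           {q \<in> hyperplane G (of_int d).
              \<forall>I \<subseteq> verts G. \<bar>sum q I - qD G len D I\<bar> \<le> real (eD_num G len D I (verts G - I)) / 2}
       \<and> semistability_polytope G len D = base_polytope G (muD G len D) (muD_star G len D)"
proof (intro conjI)
  have len: "\<forall>e \<in> arcs G. 0 < len e"
    using assms(2) by blast
  note between = semistability_polytope_eq_between[OF assms(1) len assms(3,4)]
  show "semistability_polytope G len D =
      {q \<in> hyperplane G (of_int d).
         \<forall>I \<subseteq> verts G. \<bar>sum q I - qD G len D I\<bar> \<le> real (eD_num G len D I (verts G - I)) / 2}"
    unfolding between between_muD_iff_near_qD assms(5) by (rule refl)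
  have "{q \<in> hyperplane G (of_int (div_degree D)).
          \<forall>I \<subseteq> verts G. muD G len D I \<le> sum q I \<and> sum q I \<le> muD_star G len D I}
      = hyperplane G (of_int (div_degree D)) \<inter> base_polytope G (muD G len D) (muD_star G len D)"
    by (auto simp: base_polytope_def hyperplane_def)
  then show "semistability_polytope G len D = base_polytope G (muD G len D) (muD_star G len D)"
    using base_polytope_subset_hyperplane[OF fin_digraph.axioms(1)[OF assms(1)] assms(3)]
    unfolding between by (simp add: Int_absorb1)
qed

end
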